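(* Let $\alpha>0$ and $n\ge1$. In the adversarial-order secretary problem with an $\alpha$-power signal (defined in the context), the policy $\mathcal{A}(S)$ is optimal among deterministic policies, with worst-case success probability $$\mathrm{OPT}^{\mathrm{det}}_n(\alpha)=1-\left(1-\frac1n\right)^\alpha.$$
   Context: Notation: $[n]=\{1,\dots,n\}$. Adversarial-order secretary problem with an $\alpha$-power signal ($\alpha>0$ real): an adversary fixes an instance, i.e. a value vector $v\in\mathbb{N}_0^n$ with a unique maximum entry, located at a time $i^\star\in[n]$. Items arrive one by one at times $1,\dots,n$ in this order. A signal time $S\in[i^\star]$ is drawn with $$\Pr[S=s]=\frac{s^\alpha-(s-1)^\alpha}{(i^\star)^\alpha},\qquad s\in[i^\star].$$ At each time $t$ the policy observes $v_t$ and whether the content-free signal occurs at time $t$ ($S=t$); it then irrevocably decides whether to stop at time $t$. The policy knows $n$ and $\alpha$, but not the instance. It succeeds if it stops exactly at time $i^\star$. A deterministic policy uses no internal randomness: its decision at time $t$ is a function of the observations up to time $t$. The worst-case success probability of a policy is the infimum over all instances of length $n$ of its success probability (over the signal); $\mathrm{OPT}^{\mathrm{det}}_n(\alpha)$ is the supremum of the worst-case success probability over all deterministic policies, and a deterministic policy is optimal if it attains it. A time is a record if the item arriving then is the best item so far. The policy $\mathcal{A}(S)$ rejects all items before the signal time $S$ and then accepts the first record from time $S$ onward (including time $S$). *)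

theory Defs
  imports "HOL-Probability.Probability"
begin

text \<open>Times are $1, \dots, n$; a value vector is a function that is extensional outside
  \<open>{1..n}\<close>.\<close>

definition unique_max_at :: "nat \<Rightarrow> (nat \<Rightarrow> nat) \<Rightarrow> nat \<Rightarrow> bool" where
  "unique_max_at n v i \<longleftrightarrow> i \<in> {1..n} \<and> (\<forall>j\<in>{1..n} - {i}. v j < v i)"

definition instances :: "nat \<Rightarrow> (nat \<Rightarrow> nat) set" where
  "instances n = {v \<in> {1..n} \<rightarrow>\<^sub>E UNIV. \<exists>i. unique_max_at n v i}"

definition best_time :: "nat \<Rightarrow> (nat \<Rightarrow> nat) \<Rightarrow> nat" where
  "best_time n v = (THE i. unique_max_at n v i)"

lemma best_time_eq:
  assumes "unique_max_at n v i"
  shows "best_time n v = i"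
  unfolding best_time_def
proof (rule the_equality, rule assms)
  fix j assume "unique_max_at n v j"
  with assms show "j = i"
    unfolding unique_max_at_def by (metis DiffI less_asym singletonD)
qed

definition signal_weight :: "real \<Rightarrow> nat \<Rightarrow> nat \<Rightarrow> real" where
  "signal_weight \<alpha> i s =
     (if s \<in> {1..i} then (real s powr \<alpha> - (real s - 1) powr \<alpha>) / real i powr \<alpha> else 0)"

definition signal_pmf :: "real \<Rightarrow> nat \<Rightarrow> nat pmf" where
  "signal_pmf \<alpha> i = embed_pmf (signal_weight \<alpha> i)"

text \<open>\<open>embed_pmf\<close> is only meaningful for nonnegative weights of total mass 1, which holds here.\<close>

lemma pmf_signal_pmf:
  assumes "\<alpha> > 0" "i \<ge> 1"
  shows "pmf (signal_pmf \<alpha> i) s = signal_weight \<alpha> i s"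
proof -
  have nonneg: "signal_weight \<alpha> i t \<ge> 0" for t
    using assms by (auto simp: signal_weight_def intro!: divide_nonneg_nonneg powr_mono2)
  have tele: "(\<Sum>t=1..m. real t powr \<alpha> - (real t - 1) powr \<alpha>) = real m powr \<alpha>" for m
    using assms by (induction m) auto
  have "(\<Sum>t=1..i. signal_weight \<alpha> i t)
      = (\<Sum>t=1..i. real t powr \<alpha> - (real t - 1) powr \<alpha>) / real i powr \<alpha>"
    by (simp add: signal_weight_def sum_divide_distrib)
  also have "\<dots> = 1"
    using assms by (simp only: tele) simp
  finally have sum1: "(\<Sum>t=1..i. signal_weight \<alpha> i t) = 1" .
  have "(\<integral>\<^sup>+ t. ennreal (signal_weight \<alpha> i t) \<partial>count_space UNIV)
      = (\<Sum>t\<in>{1..i}. ennreal (signal_weight \<alpha> i t))"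
    by (rule nn_integral_count_space'[where A = "{1..i}"]) (auto simp: signal_weight_def)
  also have "\<dots> = 1"
    using sum1 nonneg by (simp add: sum_ennreal)
  finally show ?thesis
    unfolding signal_pmf_def using nonneg by (subst pmf_embed_pmf) auto
qed

text \<open>A history lists, for each time so far, the value and whether the signal occurred. A
  deterministic policy maps histories to decisions (\<open>True\<close> means stop); its decisions after the
  first stop are irrelevant.\<close>

type_synonym history = "(nat \<times> bool) list"
type_synonym det_policy = "history \<Rightarrow> bool"

definition history_upto :: "(nat \<Rightarrow> nat) \<Rightarrow> nat \<Rightarrow> nat \<Rightarrow> history" where
  "history_upto v s t = map (\<lambda>j. (v j, s = j)) [1..<Suc t]"

definition stops_at :: "det_policy \<Rightarrow> (nat \<Rightarrow> nat) \<Rightarrow> nat \<Rightarrow> nat \<Rightarrow> bool" where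
  "stops_at \<pi> v s t \<longleftrightarrow>
     \<pi> (history_upto v s t) \<and> (\<forall>t'\<in>{1..<t}. \<not> \<pi> (history_upto v s t'))"

definition success_prob :: "nat \<Rightarrow> real \<Rightarrow> det_policy \<Rightarrow> (nat \<Rightarrow> nat) \<Rightarrow> real" where
  "success_prob n \<alpha> \<pi> v =
     measure_pmf.prob (signal_pmf \<alpha> (best_time n v)) {s. stops_at \<pi> v s (best_time n v)}"

definition worst_case_prob :: "nat \<Rightarrow> real \<Rightarrow> det_policy \<Rightarrow> real" where
  "worst_case_prob n \<alpha> \<pi> = (INF v\<in>instances n. success_prob n \<alpha> \<pi> v)"

definition OPT_det :: "nat \<Rightarrow> real \<Rightarrow> real" where
  "OPT_det n \<alpha> = (SUP \<pi>. worst_case_prob n \<alpha> \<pi>)"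

definition optimal_det :: "nat \<Rightarrow> real \<Rightarrow> det_policy \<Rightarrow> bool" where
  "optimal_det n \<alpha> \<pi> \<longleftrightarrow> worst_case_prob n \<alpha> \<pi> = OPT_det n \<alpha>"

text \<open>The infimum and supremum above are over nonempty, bounded sets of reals.\<close>

lemma instances_nonempty: "n \<ge> 1 \<Longrightarrow> instances n \<noteq> {}"
proof -
  assume "n \<ge> 1"
  then have "unique_max_at n (\<lambda>j\<in>{1..n}. j) n"
    by (auto simp: unique_max_at_def)
  then have "(\<lambda>j\<in>{1..n}. j) \<in> instances n"
    unfolding instances_def by auto
  then show ?thesis by blast
qed

lemma success_prob_bounds: "0 \<le> success_prob n \<alpha> \<pi> v" "success_prob n \<alpha> \<pi> v \<le> 1"
  by (auto simp: success_prob_def)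

lemma bdd_below_success_prob: "bdd_below (success_prob n \<alpha> \<pi> ` A)"
  using success_prob_bounds(1) by (auto intro!: bdd_belowI[of _ 0])

lemma bdd_above_worst_case_prob:
  assumes "n \<ge> 1"
  shows "bdd_above (range (worst_case_prob n \<alpha>))"
proof (rule bdd_aboveI[of _ 1], clarify)
  fix \<pi>
  obtain v where v: "v \<in> instances n"
    using instances_nonempty[OF assms] by blast
  have "worst_case_prob n \<alpha> \<pi> \<le> success_prob n \<alpha> \<pi> v"
    unfolding worst_case_prob_def by (rule cINF_lower[OF bdd_below_success_prob v])
  also have "\<dots> \<le> 1" by (rule success_prob_bounds)
  finally show "worst_case_prob n \<alpha> \<pi> \<le> 1" .
qed

text \<open>Non-maximal values may tie; repeating an earlier value does not make a record.\<close>

definition is_record :: "(nat \<Rightarrow> nat) \<Rightarrow> nat \<Rightarrow> bool" where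
  "is_record v t \<longleftrightarrow> (\<forall>j\<in>{1..<t}. v j < v t)"

text \<open>The policy $\mathcal{A}(S)$: the signal has occurred and the current item is a record.\<close>

definition signal_record_policy :: det_policy where
  "signal_record_policy h \<longleftrightarrow>
     (\<exists>x\<in>set h. snd x) \<and> (\<forall>x\<in>set (butlast h). fst x < fst (last h))"

lemma signal_record_policy_history_upto:
  assumes "s \<ge> 1"
  shows "signal_record_policy (history_upto v s t) \<longleftrightarrow> s \<le> t \<and> is_record v t"
proof (cases t)
  case 0
  then show ?thesis using assms by (simp add: signal_record_policy_def history_upto_def)
next
  case (Suc m)
  let ?f = "\<lambda>j. (v j, s = j)"
  have h: "history_upto v s t = map ?f [1..<t] @ [?f t]"
    using Suc by (simp add: history_upto_def)
  have "(\<exists>x\<in>set (history_upto v s t). snd x) \<longleftrightarrow> s \<le> t"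
    using assms Suc unfolding h by auto
  moreover have "(\<forall>x\<in>set (butlast (history_upto v s t)). fst x < fst (last (history_upto v s t)))
      \<longleftrightarrow> is_record v t"
    unfolding h by (auto simp: is_record_def)
  ultimately show ?thesis
    by (simp add: signal_record_policy_def)
qed

lemma stops_at_signal_record_policy:
  assumes "s \<ge> 1"
  shows "stops_at signal_record_policy v s t \<longleftrightarrow>
    s \<le> t \<and> is_record v t \<and> (\<forall>t'\<in>{s..<t}. \<not> is_record v t')"
  using assms unfolding stops_at_def by (auto simp: signal_record_policy_history_upto)

end

(* Lower bound: A(S) certainly succeeds if S is the best time i, which has probability
   1 - (1 - 1/i)^alpha \<ge> 1 - (1 - 1/n)^alpha.
   Upper bound: consider the instances that increase up to time i and vanish afterwards. Let W i be
   the set of signal times with which a given policy succeeds on the i-th one. Up to time i this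
   instance looks like the increasing sequence, on which the policy stops only once for each signal
   time, so the W i \<subseteq> {1..i} are disjoint. If one of them is empty, the worst case is 0. Otherwise
   W i = {i} for all i by induction, so on the n-th instance the policy succeeds only if S = n. *)
theory Submission
  imports Defs
begin

lemma best_time_unique_max:
  assumes "v \<in> instances n"
  shows "unique_max_at n v (best_time n v)"
  using assms best_time_eq unfolding instances_def by blast

lemma set_signal_pmf:
  assumes "\<alpha> > 0" "i \<ge> 1"
  shows "set_pmf (signal_pmf \<alpha> i) \<subseteq> {1..i}"
  using pmf_signal_pmf[OF assms] by (auto simp: set_pmf_eq signal_weight_def split: if_splits)

lemma pmf_signal_pmf_last:
  assumes "\<alpha> > 0" "i \<ge> 1"
  shows "pmf (signal_pmf \<alpha> i) i = 1 - (1 - 1 / real i) powr \<alpha>"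
proof -
  have "1 - 1 / real i = (real i - 1) / real i"
    using assms by (simp add: field_simps)
  then have "(1 - 1 / real i) powr \<alpha> = (real i - 1) powr \<alpha> / real i powr \<alpha>"
    using assms by (simp only: powr_divide)
  then show ?thesis
    using assms by (simp add: pmf_signal_pmf signal_weight_def diff_divide_distrib)
qed

text \<open>At the later of two distinct times, the earlier stop would violate the no-stop-before
  clause. This is what makes the success events of different instances disjoint.\<close>

lemma stops_at_inject:
  assumes "stops_at \<pi> v s t" "stops_at \<pi> v s t'" "t \<ge> 1" "t' \<ge> 1"
  shows "t = t'"
  using assms unfolding stops_at_def by (cases t t' rule: linorder_cases) auto

lemma history_upto_cong:
  assumes "\<And>j. j \<in> {1..t} \<Longrightarrow> v j = w j"
  shows "history_upto v s t = history_upto w s t"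
  using assms by (auto simp: history_upto_def)

text \<open>A policy cannot see the future: histories up to \<open>t\<close> involve values up to
  \<open>t\<close> only. Hence instances sharing a prefix are indistinguishable on it.\<close>

lemma stops_at_cong:
  assumes "\<And>j. j \<in> {1..t} \<Longrightarrow> v j = w j"
  shows "stops_at \<pi> v s t \<longleftrightarrow> stops_at \<pi> w s t"
proof -
  have "history_upto v s t' = history_upto w s t'" if "t' \<le> t" for t'
    using assms that by (intro history_upto_cong) auto
  then show ?thesis by (auto simp: stops_at_def)
qed

lemma worst_case_prob_le:
  "v \<in> instances n \<Longrightarrow> worst_case_prob n \<alpha> \<pi> \<le> success_prob n \<alpha> \<pi> v"
  unfolding worst_case_prob_def by (rule cINF_lower[OF bdd_below_success_prob])

lemma signal_record_policy_success_ge: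
  assumes "\<alpha> > 0" and v: "v \<in> instances n"
  shows "success_prob n \<alpha> signal_record_policy v \<ge> 1 - (1 - 1 / real n) powr \<alpha>"
proof -
  define i where "i = best_time n v"
  have max: "unique_max_at n v i"
    unfolding i_def using v by (rule best_time_unique_max)
  then have i: "1 \<le> i" "i \<le> n"
    by (auto simp: unique_max_at_def)
  have "stops_at signal_record_policy v i i"
    using max i by (auto simp: stops_at_signal_record_policy is_record_def unique_max_at_def)
  then have "measure_pmf.prob (signal_pmf \<alpha> i) {i} \<le> success_prob n \<alpha> signal_record_policy v"
    unfolding success_prob_def i_def[symmetric] by (intro measure_pmf.finite_measure_mono) auto
  \<comment> \<open>The mass of the last signal time decreases in \<open>i\<close>, so
    \<open>i = n\<close> is the worst case; \<open>i \<ge> 1\<close> keeps the base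
    nonnegative.\<close>
  moreover have "(1 - 1 / real i) powr \<alpha> \<le> (1 - 1 / real n) powr \<alpha>"
    using assms i by (intro powr_mono2) (auto simp: frac_le)
  ultimately show ?thesis
    using assms i by (simp add: measure_pmf_single pmf_signal_pmf_last)
qed

lemma worst_case_prob_signal_record_policy_ge:
  assumes "\<alpha> > 0" "n \<ge> 1"
  shows "worst_case_prob n \<alpha> signal_record_policy \<ge> 1 - (1 - 1 / real n) powr \<alpha>"
  unfolding worst_case_prob_def using assms
  by (intro cINF_greatest instances_nonempty signal_record_policy_success_ge)

text \<open>The peak value \<open>i\<close> is positive, so it strictly beats the zeros after it.
  Passing to the identity sequence, the same for every \<open>i\<close>, lets the success events for
  different \<open>i\<close> be compared.\<close>

lemma success_prob_rising:
  fixes \<pi> :: det_policy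
  assumes "\<alpha> > 0" "i \<in> {1..n}"
  defines "v \<equiv> \<lambda>j\<in>{1..n}. if j \<le> i then j else 0"
  shows "v \<in> instances n"
    and "success_prob n \<alpha> \<pi> v =
      measure_pmf.prob (signal_pmf \<alpha> i) {s\<in>{1..i}. stops_at \<pi> (\<lambda>j. j) s i}"
proof -
  have max: "unique_max_at n v i"
    using assms by (auto simp: unique_max_at_def)
  then show "v \<in> instances n"
    unfolding instances_def by (auto simp: v_def)
  have "stops_at \<pi> v s i \<longleftrightarrow> stops_at \<pi> (\<lambda>j. j) s i" for s
    using assms by (intro stops_at_cong) auto
  then show "success_prob n \<alpha> \<pi> v =
      measure_pmf.prob (signal_pmf \<alpha> i) {s\<in>{1..i}. stops_at \<pi> (\<lambda>j. j) s i}"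
    unfolding success_prob_def best_time_eq[OF max]
    using assms set_signal_pmf[of \<alpha> i]
    \<comment> \<open>Restricting to signal times in \<open>{1..i}\<close> discards only a null
      set.\<close>
    by (intro measure_pmf.finite_measure_eq_AE) (auto simp: AE_measure_pmf_iff)
qed

text \<open>Strong induction: an element \<open>s < i\<close> of \<open>W i\<close> would also lie
  in \<open>W s = {s}\<close>, against disjointness. So \<open>i\<close> is the only element left
  for the nonempty \<open>W i\<close>.\<close>

lemma disjoint_nonempty_initial_segments:
  fixes W :: "nat \<Rightarrow> nat set"
  assumes "\<And>i. i \<in> {1..n} \<Longrightarrow> W i \<subseteq> {1..i}"
    and "\<And>i. i \<in> {1..n} \<Longrightarrow> W i \<noteq> {}"
    and "disjoint_family_on W {1..n}"
  shows "i \<in> {1..n} \<Longrightarrow> W i = {i}"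
proof (induction i rule: less_induct)
  case (less i)
  have "s = i" if "s \<in> W i" for s
  proof (rule ccontr)
    assume "s \<noteq> i"
    then have s: "s < i" "s \<in> {1..n}"
      using assms(1)[OF less.prems] that less.prems by auto
    then have "s \<in> W s" using less.IH by blast
    moreover have "W s \<inter> W i = {}"
      using assms(3) s less.prems by (intro disjoint_family_onD) auto
    ultimately show False using that by blast
  qed
  then show ?case using assms(2)[OF less.prems] by blast
qed

lemma worst_case_prob_upper_bound:
  assumes "\<alpha> > 0" "n \<ge> 1"
  shows "worst_case_prob n \<alpha> \<pi> \<le> 1 - (1 - 1 / real n) powr \<alpha>"
proof -
  define W where "W i = {s\<in>{1..i}. stops_at \<pi> (\<lambda>j. j) s i}" for i
  have le: "worst_case_prob n \<alpha> \<pi> \<le> measure_pmf.prob (signal_pmf \<alpha> i) (W i)"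
    if "i \<in> {1..n}" for i
    using worst_case_prob_le success_prob_rising[OF assms(1) that] unfolding W_def by metis
  show ?thesis
  proof (cases "\<exists>i\<in>{1..n}. W i = {}")
    case True
    then have "worst_case_prob n \<alpha> \<pi> \<le> 0"
      using le by force
    \<comment> \<open>The claimed bound is itself a point mass, hence nonnegative.\<close>
    also have "0 \<le> pmf (signal_pmf \<alpha> n) n" by simp
    finally show ?thesis using assms by (simp add: pmf_signal_pmf_last)
  next
    case False
    have "disjoint_family_on W {1..n}"
      unfolding disjoint_family_on_def W_def by (auto dest: stops_at_inject)
    then have "W n = {n}"
      using False assms by (intro disjoint_nonempty_initial_segments[of n W]) (auto simp: W_def)
    \<comment> \<open>The bound is now the probability that the signal comes at time
      \<open>n\<close> when the best time is \<open>n\<close>.\<close>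
    then show ?thesis
      using le[of n] assms by (simp add: measure_pmf_single pmf_signal_pmf_last)
  qed
qed

theorem theorem6:
  fixes \<alpha> :: real and n :: nat
  assumes "\<alpha> > 0" and "n \<ge> 1"
  shows "optimal_det n \<alpha> signal_record_policy
       \<and> worst_case_prob n \<alpha> signal_record_policy = 1 - (1 - 1 / real n) powr \<alpha>
       \<and> OPT_det n \<alpha> = 1 - (1 - 1 / real n) powr \<alpha>"
proof -
  have wc: "worst_case_prob n \<alpha> signal_record_policy = 1 - (1 - 1 / real n) powr \<alpha>"
    using worst_case_prob_upper_bound[OF assms] worst_case_prob_signal_record_policy_ge[OF assms]
    by (rule antisym)
  have "worst_case_prob n \<alpha> \<pi> \<le> worst_case_prob n \<alpha> signal_record_policy" for \<pi>
    unfolding wc by (rule worst_case_prob_upper_bound[OF assms])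
  then have "OPT_det n \<alpha> = worst_case_prob n \<alpha> signal_record_policy"
    unfolding OPT_det_def by (intro cSup_eq_maximum) auto
  with wc show ?thesis by (simp add: optimal_det_def)
qed

end
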